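(* For every integer $n>4$, the number of prime numbers in the open interval $(8n,9n)$ is at least \[\log_{9n}\left[32549.3\,e^{-1.001102\left(\frac{9n}{19}\right)}n^{-13}\left(\frac{9^9}{8^8}\right)^{\frac{17n}{105}}(9n)^{-\frac{2.51012\sqrt{9n}}{\log(9n)}}\right].\]
   Context: $\log$ denotes the natural logarithm and $\log_{b} x=\log x/\log b$ is the logarithm to base $b$. *)

theory Defs
  imports Complex_Main "HOL-Computational_Algebra.Primes"
begin

end

theory Submission
  imports Defs "HOL-Number_Theory.Prime_Powers" "HOL-Analysis.Harmonic_Numbers"
begin

text \<open>
  The logarithm of the bracket is at most \<open>0.0342 n - 7.53 sqrt n\<close>, which is negative below
  \<open>n = 40000\<close>. For larger \<open>n\<close> a variant of Chebyshev's method suffices. Since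
  \<open>ln (fact N)\<close> is the sum of \<open>\<Lambda>(d) (N div d)\<close>, a combination of the numbers
  \<open>ln (fact (X div m))\<close> with weights \<open>v\<close> satisfying \<open>\<Sum> v / m = 0\<close> is both
  \<open>- X \<Sum> v ln m / m + O(ln X)\<close> and a sum of \<open>\<Lambda>(d) F(X div d)\<close> for a periodic \<open>F\<close>.
  Chebyshev's weights on 1, 2, 3, 5, 30 give \<open>0.9212 x \<le> \<psi>(x) \<le> 1.1056 x\<close> up to powers of
  logarithms. With \<open>X = 72 n\<close>, fourteen weights on multiples of 8 and 9 make \<open>F\<close> at most the
  indicator of \<open>{8}\<close>, which contributes \<open>\<psi>(9n) - \<psi>(8n)\<close>, plus five step functions whose
  contribution those two bounds control; this yields \<open>\<psi>(9n) - \<psi>(8n) \<ge> 0.065 n\<close> up to smaller terms.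
  As \<open>9 / 8 < 2\<close>, each prime has at most one power in \<open>(8n, 9n]\<close>, so the proper prime powers
  cost at most \<open>\<psi>(sqrt (9n))\<close>.
\<close>

section \<open>Factorials as sums of the von Mangoldt function\<close>

definition chebyshev_psi :: "nat \<Rightarrow> real" where
  "chebyshev_psi n = (\<Sum>d = 1..n. mangoldt d)"

text \<open>The function \<open>F\<close> of the overview, for weights \<open>v\<close> at divisors
  \<open>m\<close>.\<close>

definition kernel_sum :: "(nat \<times> int) list \<Rightarrow> nat \<Rightarrow> int" where
  "kernel_sum c y = (\<Sum>(m, v)\<leftarrow>c. v * int (y div m))"

text \<open>Majorants have this shape because a threshold at \<open>k\<close> sums against
  \<open>mangoldt\<close> to \<open>chebyshev_psi (n div k)\<close>.\<close>

definition step_sum :: "(nat \<times> int) list \<Rightarrow> nat \<Rightarrow> int" where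
  "step_sum g y = (\<Sum>(k, v)\<leftarrow>g. if k \<le> y then v else 0)"

text \<open>From \<open>n\<close> to \<open>n + 1\<close> the quotient by \<open>d\<close> grows
  exactly when \<open>d\<close> divides \<open>n + 1\<close>, and \<open>mangoldt\<close> sums to
  \<open>ln (n + 1)\<close> over these divisors.\<close>

lemma ln_fact_eq_sum_mangoldt:
  "ln (fact n) = (\<Sum>d = 1..n. mangoldt d * real (n div d))"
proof (induction n)
  case (Suc n)
  have div_Suc: "real (Suc n div d) = real (n div d) + (if d dvd Suc n then 1 else 0)"
    for d :: nat
    by (auto simp: div_Suc dvd_eq_mod_eq_0)
  have "(\<Sum>d = 1..Suc n. mangoldt d * real (Suc n div d)) =
        (\<Sum>d = 1..Suc n. mangoldt d * real (n div d)) +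
        (\<Sum>d = 1..Suc n. if d dvd Suc n then mangoldt d else (0 :: real))"
    unfolding div_Suc sum.distrib[symmetric] by (intro sum.cong) (auto simp: algebra_simps)
  also have "(\<Sum>d = 1..Suc n. if d dvd Suc n then mangoldt d else (0 :: real)) =
             (\<Sum>d | d dvd Suc n. mangoldt d)"
    unfolding sum.If_cases[OF finite_atLeastAtMost]
    by (simp, intro sum.cong) (auto dest: dvd_imp_le intro!: Nat.gr0I simp: Suc_le_eq)
  also have "\<dots> = ln (real (Suc n))"
    by (subst mangoldt_sum) auto
  also have "(\<Sum>d = 1..Suc n. mangoldt d * real (n div d)) = ln (fact n)"
    using Suc.IH by simp
  finally show ?case
    by (simp add: ln_mult)
qed simp

text \<open>Terms beyond \<open>n div m\<close> vanish; the common range up to \<open>n\<close> lets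
  different \<open>m\<close> be combined termwise.\<close>

lemma ln_fact_div_eq_sum_mangoldt:
  "ln (fact (n div m)) = (\<Sum>d = 1..n. mangoldt d * real (n div d div m))"
proof -
  have "ln (fact (n div m)) = (\<Sum>d = 1..n div m. mangoldt d * real (n div d div m))"
    unfolding ln_fact_eq_sum_mangoldt by (simp add: div_mult2_eq[symmetric] mult.commute)
  also have "\<dots> = (\<Sum>d = 1..n. mangoldt d * real (n div d div m))"
  proof (intro sum.mono_neutral_left ballI)
    show "{1..n div m} \<subseteq> {1..n}"
      using div_le_dividend[of n m] by (auto intro: order_trans)
    fix d assume "d \<in> {1..n} - {1..n div m}"
    hence "n div d div m = 0"
      by (auto simp: div_mult2_eq[symmetric] mult.commute[of d])
         (simp add: div_mult2_eq)
    thus "mangoldt d * real (n div d div m) = 0" by simp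
  qed auto
  finally show ?thesis .
qed

lemma sum_list_ln_fact_eq:
  "(\<Sum>(m, v)\<leftarrow>c. real_of_int v * ln (fact (n div m))) =
   (\<Sum>d = 1..n. mangoldt d * real_of_int (kernel_sum c (n div d)))"
  by (induction c)
     (auto simp: kernel_sum_def ln_fact_div_eq_sum_mangoldt sum_distrib_left algebra_simps
                 sum.distrib)

text \<open>For positive \<open>d\<close> and \<open>k\<close>, \<open>k <= n div d\<close> is
  equivalent to \<open>d <= n div k\<close>.\<close>

lemma sum_list_chebyshev_psi_eq:
  assumes "\<forall>(k, v)\<in>set g. k > 0"
  shows "(\<Sum>(k, v)\<leftarrow>g. real_of_int v * chebyshev_psi (n div k)) =
         (\<Sum>d = 1..n. mangoldt d * real_of_int (step_sum g (n div d)))"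
  using assms
proof (induction g)
  case (Cons kv g)
  obtain k v where kv: "kv = (k, v)" by force
  with Cons.prems have "k > 0" by simp
  have "(\<Sum>d = 1..n. mangoldt d * (if k \<le> n div d then real_of_int v else 0)) =
        (\<Sum>d = 1..n. if k \<le> n div d then real_of_int v * mangoldt d else 0)"
    by (intro sum.cong) auto
  also have "\<dots> = (\<Sum>d | d \<in> {1..n} \<and> k \<le> n div d. real_of_int v * mangoldt d)"
    by (intro sum.inter_filter[symmetric]) auto
  also have "{d. d \<in> {1..n} \<and> k \<le> n div d} = {1..n div k}"
  proof (intro set_eqI)
    fix d
    have "d \<le> n" if "d * k \<le> n" using that \<open>k > 0\<close> by (cases k) auto
    thus "d \<in> {d \<in> {1..n}. k \<le> n div d} \<longleftrightarrow> d \<in> {1..n div k}"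
      using \<open>k > 0\<close> by (auto simp: less_eq_div_iff_mult_less_eq mult.commute)
  qed
  finally show ?case
    using Cons
    by (simp add: kv step_sum_def chebyshev_psi_def sum_distrib_left algebra_simps sum.distrib
             split: if_splits cong: if_cong) (simp add: if_distrib if_distribR cong: if_cong)
qed (simp add: step_sum_def)

section \<open>Growth of factorials and the general kernel inequality\<close>

text \<open>The induction step amounts to
  \<open>n (ln (n + 1) - ln n) <= 1 <= (n + 1) (ln (n + 1) - ln n)\<close>.\<close>

lemma ln_fact_bounds:
  assumes "n > 0"
  shows "real n * ln n - n + 1 \<le> ln (fact n)" "ln (fact n) \<le> real n * ln n - n + 1 + ln n"
proof -
  have "real n * ln n - n + 1 \<le> ln (fact n) \<and> ln (fact n) \<le> real n * ln n - n + 1 + ln n"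
    using assms
  proof (induction n rule: nat_induct_non_zero)
    case (Suc n)
    have "1 + 1 / real n = (1 + real n) / real n" using Suc.hyps by (simp add: field_simps)
    hence *: "ln (1 + real n) - ln n = ln (1 + 1 / real n)"
      "ln (real n / (1 + real n)) = ln n - ln (1 + real n)"
      using Suc.hyps by (simp_all add: ln_div)
    have "ln (1 + real n) - ln n \<le> 1 / real n"
      unfolding * by (rule ln_add_one_self_le_self) simp
    hence 1: "n * (ln (1 + real n) - ln n) \<le> 1"
      using Suc.hyps by (simp add: field_simps)
    have "ln n - ln (1 + real n) \<le> real n / (1 + real n) - 1"
      unfolding *(2)[symmetric] using Suc.hyps by (intro ln_le_minus_one) auto
    hence "(1 + real n) * (ln n - ln (1 + real n)) \<le> (1 + real n) * (real n / (1 + real n) - 1)"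
      by (intro mult_left_mono) auto
    also have "\<dots> = -1" by (simp add: field_simps)
    finally have 2: "(1 + real n) * (ln (1 + real n) - ln n) \<ge> 1" by (simp add: algebra_simps)
    have "ln (fact (Suc n)) = ln (1 + real n) + ln (fact n)" by (simp add: ln_mult)
    with 1 2 Suc.IH show ?case by (simp add: algebra_simps)
  qed simp
  thus "real n * ln n - n + 1 \<le> ln (fact n)" "ln (fact n) \<le> real n * ln n - n + 1 + ln n" by auto
qed

lemma mult_ln_minus_mono:
  fixes x y :: real
  assumes "1 \<le> x" "x \<le> y"
  shows "x * ln x - x \<le> y * ln y - y"
proof (rule DERIV_nonneg_imp_nondecreasing[OF \<open>x \<le> y\<close>])
  fix z assume "x \<le> z" "z \<le> y"
  thus "\<exists>D. ((\<lambda>z. z * ln z - z) has_real_derivative D) (at z) \<and> 0 \<le> D"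
    using assms by (intro exI[of _ "ln z"]) (auto intro!: derivative_eq_intros)
qed

text \<open>For \<open>n >= m\<close>, the real quotient lies between \<open>k = n div m\<close> and
  \<open>k + 1\<close>, \<open>x ln x - x\<close> increases from 1 on, and consecutive
  log-factorials differ by only \<open>ln (k + 1)\<close>.\<close>

lemma ln_fact_div_bound:
  assumes "n > 0" "m > 0"
  shows "\<bar>ln (fact (n div m)) - (real n / m * ln (real n / m) - real n / m)\<bar> \<le> ln n + 1"
proof (cases "n < m")
  case True
  \<comment> \<open>Monotonicity fails below 1, but here the factorial is 1 and
    \<open>z ln z - z\<close> lies between -1 and 0.\<close>
  define z where "z = real n / m"
  have z: "0 < z" "z \<le> 1" using True assms by (auto simp: z_def)
  have "ln z \<le> z - 1" using z by (intro ln_le_minus_one) auto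
  moreover have "ln (1 / z) \<le> 1 / z - 1" using z by (intro ln_le_minus_one) auto
  hence "-ln z \<le> 1 / z - 1" using z by (simp add: ln_div)
  hence "z * (-ln z) \<le> z * (1 / z - 1)" using z by (intro mult_left_mono) auto
  hence "z * ln z \<ge> z - 1" using z by (simp add: algebra_simps)
  moreover have "z * ln z \<le> 0" using z by (simp add: mult_nonneg_nonpos)
  moreover have "ln (real n) \<ge> 0" using assms by simp
  ultimately show ?thesis using True z unfolding z_def[symmetric] by (simp add: abs_le_iff)
next
  case False
  define z where "z = real n / m"
  define k where "k = n div m"
  have k: "k > 0" using False assms by (simp add: k_def div_greater_zero_iff)
  have kz: "real k \<le> z" unfolding k_def z_def by (rule of_nat_div_le_of_nat)
  have zk: "z \<le> 1 + real k"
  proof -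
    have "n \<le> (1 + k) * m"
      unfolding k_def using assms dividend_less_div_times[of m n] by (simp add: algebra_simps)
    hence "real n \<le> real ((1 + k) * m)" by (simp only: of_nat_le_iff)
    thus ?thesis using assms by (simp add: z_def field_simps)
  qed
  have "ln (1 + real k) \<le> ln n + 1"
  proof -
    have "k \<le> n" by (simp add: k_def)
    hence "ln (1 + real k) \<le> ln (2 * real n)" using k assms by (subst ln_le_cancel_iff) auto
    also have "\<dots> = ln 2 + ln n" using assms by (simp add: ln_mult)
    finally show ?thesis using ln_2_less_1 by simp
  qed
  moreover have "ln (fact k) = ln (fact (Suc k)) - ln (1 + real k)" by (simp add: ln_mult)
  moreover have "(1 + real k) * ln (1 + real k) - (1 + real k) + 1 \<le> ln (fact (Suc k))"
    using ln_fact_bounds(1)[of "Suc k"] by simp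
  moreover have "z * ln z - z \<le> (1 + real k) * ln (1 + real k) - (1 + real k)"
    using k kz zk by (intro mult_ln_minus_mono) auto
  moreover have "real k * ln k - k \<le> z * ln z - z"
    using k kz by (intro mult_ln_minus_mono) auto
  moreover have "ln (fact k) \<le> real k * ln k - k + 1 + ln k" using ln_fact_bounds(2) k by simp
  moreover have "k \<le> n" by (simp add: k_def)
  hence "ln k \<le> ln n" using k by simp
  ultimately show ?thesis unfolding k_def[symmetric] z_def[symmetric] by (simp add: abs_le_iff)
qed

text \<open>Expanding \<open>ln (n / m)\<close> isolates a multiple of the sum of
  \<open>v / m\<close>, which balanced weights cancel.\<close>

lemma sum_list_ln_fact_bound:
  assumes "n > 0" "\<forall>(m, v)\<in>set c. m > 0"
  shows "\<bar>(\<Sum>(m, v)\<leftarrow>c. real_of_int v * ln (fact (n div m))) -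
          (n * (ln n - 1) * (\<Sum>(m, v)\<leftarrow>c. real_of_int v / real m)
           - n * (\<Sum>(m, v)\<leftarrow>c. real_of_int v * ln (real m) / real m))\<bar>
         \<le> (\<Sum>(m, v)\<leftarrow>c. \<bar>real_of_int v\<bar>) * (ln n + 1)"
  using assms(2)
proof (induction c)
  case (Cons mv c)
  obtain m v where mv: "mv = (m, v)" by force
  with Cons.prems have m: "m > 0" by simp
  define e where "e = ln (fact (n div m)) - (real n / m * ln (real n / m) - real n / m)"
  have "\<bar>e\<bar> \<le> ln n + 1" unfolding e_def using ln_fact_div_bound assms m by blast
  hence "\<bar>v * e\<bar> \<le> \<bar>v\<bar> * (ln n + 1)" by (simp add: abs_mult mult_left_mono)
  moreover have "v * ln (fact (n div m)) = v * e + (n * (ln n - 1) * (v / m) - n * (v * ln m / m))"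
    using assms m by (simp add: e_def ln_div field_simps)
  ultimately show ?case using Cons by (simp add: mv algebra_simps)
qed simp

text \<open>The source of all three kernel estimates for \<open>chebyshev_psi\<close>. As
  \<open>mangoldt\<close> is nonnegative, a pointwise comparison of kernel and steps passes to the
  sums.\<close>

lemma kernel_bound:
  assumes "n > 0" "\<forall>(m, v)\<in>set c. m > 0" "\<forall>(k, v)\<in>set g. k > 0"
    and "(\<Sum>(m, v)\<leftarrow>c. real_of_int v / real m) = 0"
    and le: "\<And>y. kernel_sum c y \<le> step_sum g y"
  shows "- real n * (\<Sum>(m, v)\<leftarrow>c. real_of_int v * ln (real m) / real m)
         - (\<Sum>(m, v)\<leftarrow>c. \<bar>real_of_int v\<bar>) * (ln n + 1)
         \<le> (\<Sum>(k, v)\<leftarrow>g. real_of_int v * chebyshev_psi (n div k))"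
proof -
  have "- real n * (\<Sum>(m, v)\<leftarrow>c. real_of_int v * ln (real m) / real m)
         - (\<Sum>(m, v)\<leftarrow>c. \<bar>real_of_int v\<bar>) * (ln n + 1)
        \<le> (\<Sum>(m, v)\<leftarrow>c. real_of_int v * ln (fact (n div m)))"
    using sum_list_ln_fact_bound[OF assms(1,2)] assms(4) by (simp add: abs_le_iff)
  also have "\<dots> \<le> (\<Sum>d = 1..n. mangoldt d * real_of_int (step_sum g (n div d)))"
    unfolding sum_list_ln_fact_eq using le by (intro sum_mono mult_left_mono) (auto simp: mangoldt_nonneg)
  also have "\<dots> = (\<Sum>(k, v)\<leftarrow>g. real_of_int v * chebyshev_psi (n div k))"
    using sum_list_chebyshev_psi_eq[OF assms(3)] by simp
  finally show ?thesis .
qed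

section \<open>Numerical logarithms\<close>

lemma ln_2_bounds: "0.69314 \<le> ln (2 :: real)" "ln (2 :: real) \<le> 0.69315"
  using ln_approx_bounds[of 2 6]
  by (simp_all add: lessThan_nat_numeral lessThan_Suc power_numeral_reduce field_simps)

lemma ln_3_bounds: "1.09861 \<le> ln (3 :: real)" "ln (3 :: real) \<le> 1.09862"
proof -
  have "ln (3 :: real) = ln 2 + ln (3 / 2)" by (simp add: ln_div)
  thus "1.09861 \<le> ln (3 :: real)" "ln (3 :: real) \<le> 1.09862"
    using ln_approx_bounds[of "3 / 2" 4] ln_approx_bounds[of 2 6]
    by (simp_all add: lessThan_nat_numeral lessThan_Suc power_numeral_reduce field_simps)
qed

lemma ln_5_bounds: "1.60943 \<le> ln (5 :: real)" "ln (5 :: real) \<le> 1.60944"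
proof -
  have "ln (5 :: real) = 2 * ln 2 + ln (5 / 4)"
    using ln_mult[of 2 "2 :: real"] by (simp add: ln_div)
  thus "1.60943 \<le> ln (5 :: real)" "ln (5 :: real) \<le> 1.60944"
    using ln_approx_bounds[of "5 / 4" 4] ln_approx_bounds[of 2 6]
    by (simp_all add: lessThan_nat_numeral lessThan_Suc power_numeral_reduce field_simps)
qed

section \<open>Chebyshev's kernel\<close>

text \<open>The weights behind the classical integer ratio
  \<open>(30 N)! N! / ((15 N)! (10 N)! (6 N)!)\<close>.\<close>

definition chebyshev_kernel :: "(nat \<times> int) list" where
  "chebyshev_kernel = [(1, 1), (2, -1), (3, -1), (5, -1), (30, 1)]"

text \<open>Since 30 - 15 - 10 - 6 + 1 = 0, the kernel has period 30 and it suffices to check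
  residues: all values are 0 or 1, and those at 1 to 5 are 1.\<close>

lemma chebyshev_kernel_bounds:
  "kernel_sum chebyshev_kernel y \<le> step_sum [(1, 1)] y"
  "step_sum [(1, 1), (6, -1)] y \<le> kernel_sum chebyshev_kernel y"
proof -
  define q r where "q = y div 30" and "r = y mod 30"
  have y: "y = 30 * q + r" and "r < 30" by (auto simp: q_def r_def)
  have "y div 2 = 15 * q + r div 2" "y div 3 = 10 * q + r div 3" "y div 5 = 6 * q + r div 5"
    unfolding y by auto
  hence k: "kernel_sum chebyshev_kernel y = int r - r div 2 - r div 3 - r div 5"
    using \<open>r < 30\<close> unfolding kernel_sum_def chebyshev_kernel_def by (simp add: y)
  have *: "\<forall>r\<in>{0..<30}. int r - r div 2 - r div 3 - r div 5 \<le> (if 1 \<le> r then 1 else 0) \<and>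
       (if 1 \<le> r \<and> r < 6 then 1 else 0) \<le> int r - r div 2 - r div 3 - r div 5"
    by (simp add: atLeastLessThan_nat_numeral ball_Un)
  show "kernel_sum chebyshev_kernel y \<le> step_sum [(1, 1)] y"
    "step_sum [(1, 1), (6, -1)] y \<le> kernel_sum chebyshev_kernel y"
    using *[rule_format, of r] \<open>r < 30\<close> unfolding k step_sum_def by (auto simp: y split: if_splits) presburger+
qed

section \<open>A kernel isolating the interval from 8n to 9n\<close>

text \<open>
  These weights and steps come from a linear program: maximise the resulting lower bound for
  \<open>\<psi>(9n) - \<psi>(8n)\<close>, given the bounds on \<open>\<psi>\<close> obtained from Chebyshev's kernel.
\<close>

definition interval_kernel :: "(nat \<times> int) list" where
  "interval_kernel = [(8, 1), (9, -1), (16, -1), (18, 1), (24, -1), (27, 1), (40, -1), (45, 1),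
     (48, 1), (54, -1), (80, 1), (90, -1), (144, -1), (270, 1)]"

definition interval_steps :: "(nat \<times> int) list" where
  "interval_steps = [(8, 1), (9, -1), (56, 1), (63, -1), (88, 1), (153, -1), (243, 1)]"

text \<open>Common part of the two halves of \<open>interval_kernel\<close>: inclusion-exclusion
  over 2, 3, 5 without the terms for 15 and 30. Its slope is 7/30.\<close>

definition sieve6 :: "int \<Rightarrow> int" where
  "sieve6 z = z - z div 2 - z div 3 - z div 5 + z div 6 + z div 10"

lemma div_dvd_mult_add:
  fixes k m a z :: int
  assumes "k dvd m" "k \<noteq> 0"
  shows "(m * a + z) div k = m div k * a + z div k"
proof -
  obtain j where m: "m = k * j" using assms(1) by blast
  have "m * a + z = z + j * a * k" by (simp add: m)
  hence "(m * a + z) div k = j * a + z div k" using div_mult_self1[OF assms(2)] by metis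
  thus ?thesis using assms(2) by (simp add: m)
qed

lemma sieve6_add: "sieve6 (30 * a + z) = 7 * a + sieve6 z"
proof -
  have *: "(30 * a + z) div 2 = 15 * a + z div 2" "(30 * a + z) div 3 = 10 * a + z div 3"
    "(30 * a + z) div 5 = 6 * a + z div 5" "(30 * a + z) div 6 = 5 * a + z div 6"
    "(30 * a + z) div 10 = 3 * a + z div 10"
    by (subst div_dvd_mult_add; simp)+
  show ?thesis unfolding sieve6_def * by algebra
qed

lemma list_all_uptoD: "list_all P [a..b] \<Longrightarrow> a \<le> z \<Longrightarrow> z \<le> b \<Longrightarrow> P z"
  by (auto simp: list_all_iff)

text \<open>
  The kernel has period 2160, but it splits as \<open>f(y div 8) - h(y div 9)\<close> where \<open>f\<close> and \<open>h\<close> have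
  slopes \<open>8 / 45\<close> and \<open>1 / 5\<close>. Their deviations from linearity, of periods 90 and 30, already keep the
  difference below 2 outside two residue pairs, and those are incompatible with
  \<open>8 (y div 8) - 9 (y div 9) \<in> {5..8}\<close>.
\<close>

lemma sieve6_upper:
  "45 * (sieve6 u - u div 18) \<le> 8 * u + (if u mod 90 = 13 then 76 else 71)"
proof -
  define a b where "a = u div 90" and "b = u mod 90"
  have u: "u = 90 * a + b" and b: "0 \<le> b" "b < 90" by (auto simp: a_def b_def)
  have "list_all (\<lambda>b. 45 * (sieve6 b - b div 18) \<le> 8 * b + (if b = 13 then 76 else 71)) [0..89]"
    by (simp add: upto_rec1 sieve6_def)
  hence "45 * (sieve6 b - b div 18) \<le> 8 * b + (if b = 13 then 76 else 71)"
    using b by (elim list_all_uptoD) auto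
  moreover have "sieve6 u = 21 * a + sieve6 b"
    using sieve6_add[of "3 * a" b] by (simp add: u)
  moreover have "u div 18 = 5 * a + b div 18"
    unfolding u by (subst div_dvd_mult_add; simp)
  ultimately show ?thesis unfolding b_def[symmetric] by (simp add: u)
qed

lemma sieve6_lower:
  "5 * (sieve6 w - w div 30) \<ge> w - (if w mod 30 \<in> {6, 16} then 1 else 0)"
proof -
  define a b where "a = w div 30" and "b = w mod 30"
  have w: "w = 30 * a + b" and b: "0 \<le> b" "b < 30" by (auto simp: a_def b_def)
  have "list_all (\<lambda>b. 5 * sieve6 b \<ge> b - (if b \<in> {6, 16} then 1 else 0)) [0..29]"
    by (simp add: upto_rec1 sieve6_def)
  hence "5 * sieve6 b \<ge> b - (if b \<in> {6, 16} then 1 else 0)"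
    using b by (elim list_all_uptoD) auto
  thus ?thesis unfolding a_def[symmetric] b_def[symmetric] unfolding w sieve6_add by simp
qed

lemma sieve6_diff_le_1:
  fixes y :: int
  defines "u \<equiv> y div 8" and "w \<equiv> y div 9"
  shows "(sieve6 u - u div 18) - (sieve6 w - w div 30) \<le> 1"
proof (rule ccontr)
  assume *: "\<not> ?thesis"
  have uw: "8 * u \<le> y" "y \<le> 8 * u + 7" "9 * w \<le> y" "y \<le> 9 * w + 8"
    using mult_div_mod_eq[of 8 y] pos_mod_bound[of 8 y] pos_mod_sign[of 8 y]
      mult_div_mod_eq[of 9 y] pos_mod_bound[of 9 y] pos_mod_sign[of 9 y]
    unfolding u_def w_def by linarith+
  \<comment> \<open>A difference of at least 2 forces \<open>90 <= 8 u - 9 w + e\<close> with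
    \<open>8 u - 9 w <= 8\<close>, where \<open>e\<close> is 71 or 76 plus 0 or 9. Only 76 + 9 = 85
    is large enough, so both residues are exceptional and \<open>8 u - 9 w >= 5\<close>.\<close>
  have "u mod 90 = 13"
    using sieve6_upper[of u] sieve6_lower[of w] * uw by (auto split: if_splits)
  moreover have "w mod 30 \<in> {6, 16}"
    using sieve6_upper[of u] sieve6_lower[of w] * uw by (auto split: if_splits)
  ultimately obtain a b where ab: "u = 90 * a + 13" "w = 30 * b + 6 \<or> w = 30 * b + 16"
    by (metis insertE singletonD mult_div_mod_eq)
  \<comment> \<open>Now \<open>8 u - 9 w\<close> is \<open>90 t + 50\<close> or
    \<open>90 t - 40\<close>, and neither can lie between 5 and 8.\<close>
  define t where "t = 8 * a - 3 * b"
  have "8 * u - 9 * w \<ge> 5" "8 * u - 9 * w \<le> 8"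
    using sieve6_upper[of u] sieve6_lower[of w] * uw by (auto split: if_splits)
  with ab have "-45 \<le> 90 * t \<and> 90 * t \<le> -42 \<or> 45 \<le> 90 * t \<and> 90 * t \<le> 48"
    unfolding t_def by auto
  thus False by presburger
qed

lemma interval_kernel_eq:
  "kernel_sum interval_kernel y =
   (sieve6 (int (y div 8)) - int (y div 8) div 18) - (sieve6 (int (y div 9)) - int (y div 9) div 30)"
  by (simp add: kernel_sum_def interval_kernel_def sieve6_def zdiv_int zdiv_zmult2_eq[symmetric])

text \<open>From 243 on all seven steps are active and add up to 1. Below 243 the remaining
  thresholds are multiples of 8 or 9, so both sides depend only on the quotients \<open>u\<close>
  and \<open>w\<close>, leaving 27 values of \<open>w\<close> with two candidates for
  \<open>u\<close> each.\<close>

lemma interval_kernel_le: "kernel_sum interval_kernel y \<le> step_sum interval_steps y"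
proof (cases "y < 243")
  case False
  have "kernel_sum interval_kernel y \<le> 1"
    unfolding interval_kernel_eq using sieve6_diff_le_1[of "int y"] by (simp add: zdiv_int)
  thus ?thesis using False by (simp add: step_sum_def interval_steps_def)
next
  case True
  define u w where "u = int (y div 8)" and "w = int (y div 9)"
  define s where "s = (\<lambda>(u :: int) (w :: int). (if 1 \<le> u then 1 else 0) - (if 1 \<le> w then 1 else 0)
     + (if 7 \<le> u then 1 else 0) - (if 7 \<le> w then 1 else 0) + (if 11 \<le> u then 1 else 0)
     - (if 17 \<le> w then 1 else 0 :: int))"
  have w: "0 \<le> w" "w < 27" using True by (auto simp: w_def)
  have "8 * u \<le> y" "y \<le> 8 * u + 7" "9 * w \<le> y" "y \<le> 9 * w + 8"
    using div_mult_mod_eq[of y 8] mod_less_divisor[of 8 y] div_mult_mod_eq[of y 9] mod_less_divisor[of 9 y]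
    unfolding u_def w_def by linarith+
  hence "w + w div 8 \<le> u" "u \<le> w + w div 8 + 1"
    using mult_div_mod_eq[of 8 w] pos_mod_bound[of 8 w] pos_mod_sign[of 8 w] by linarith+
  hence u: "u = w + w div 8 \<or> u = w + w div 8 + 1" by linarith
  have "list_all (\<lambda>w.
     sieve6 (w + w div 8) - (w + w div 8) div 18 - sieve6 w \<le> s (w + w div 8) w \<and>
     sieve6 (w + w div 8 + 1) - (w + w div 8 + 1) div 18 - sieve6 w \<le> s (w + w div 8 + 1) w) [0..26]"
    by (simp add: upto_rec1 sieve6_def s_def)
  from list_all_uptoD[OF this, of w] u w have "sieve6 u - u div 18 - sieve6 w \<le> s u w" by auto
  moreover have "w div 30 = 0" using w by simp
  moreover have "(7 \<le> u) = (56 \<le> y)" "(7 \<le> w) = (63 \<le> y)" "(11 \<le> u) = (88 \<le> y)" "(17 \<le> w) = (153 \<le> y)"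
    "(1 \<le> u) = (8 \<le> y)" "(1 \<le> w) = (9 \<le> y)"
    unfolding u_def w_def by (simp_all add: less_eq_div_iff_mult_less_eq zdiv_int[symmetric])
  ultimately show ?thesis
    using True by (simp add: interval_kernel_eq u_def[symmetric] w_def[symmetric] s_def step_sum_def
      interval_steps_def) (auto split: if_splits)
qed

section \<open>Chebyshev's bounds for psi\<close>

lemma kernel_sum_uminus: "kernel_sum (map (\<lambda>(m, v). (m, - v)) c) y = - kernel_sum c y"
  by (induction c) (auto simp: kernel_sum_def)

lemma ln_30_eq: "ln (30 :: real) = ln 2 + ln 3 + ln 5"
  using ln_mult[of 6 "5 :: real"] ln_mult[of 2 "3 :: real"] by simp

lemma chebyshev_kernel_weights:
  "\<forall>(m, v)\<in>set chebyshev_kernel. m > 0"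
  "(\<Sum>(m, v)\<leftarrow>chebyshev_kernel. real_of_int v / real m) = 0"
  "(\<Sum>(m, v)\<leftarrow>chebyshev_kernel. \<bar>real_of_int v\<bar>) = 5"
  by (simp_all add: chebyshev_kernel_def)

text \<open>This is Chebyshev's constant \<open>ln 2 / 2 + ln 3 / 3 + ln 5 / 5 - ln 30 / 30\<close>,
  about 0.92129.\<close>

lemma chebyshev_kernel_ln_sum:
  "0.9212 \<le> - (\<Sum>(m, v)\<leftarrow>chebyshev_kernel. real_of_int v * ln (real m) / real m)"
  "- (\<Sum>(m, v)\<leftarrow>chebyshev_kernel. real_of_int v * ln (real m) / real m) \<le> 0.9213"
  using ln_2_bounds ln_3_bounds ln_5_bounds
  by (simp_all add: chebyshev_kernel_def ln_30_eq field_simps)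

lemma chebyshev_psi_ge:
  assumes "n > 0"
  shows "0.9212 * real n - 5 * (ln n + 1) \<le> chebyshev_psi n"
  using mult_left_mono[OF chebyshev_kernel_ln_sum(1), of "real n"]
    kernel_bound[OF assms chebyshev_kernel_weights(1) _ chebyshev_kernel_weights(2)
      chebyshev_kernel_bounds(1)]
  by (simp add: chebyshev_kernel_weights(3))

text \<open>Negating the kernel turns the lower estimate of \<open>kernel_bound\<close> into an
  upper one for \<open>chebyshev_psi n - chebyshev_psi (n div 6)\<close>.\<close>

lemma chebyshev_psi_le_step:
  assumes "n > 0"
  shows "chebyshev_psi n \<le> chebyshev_psi (n div 6) + 0.9213 * real n + 5 * (ln n + 1)"
proof -
  define c where "c = map (\<lambda>(m, v). (m, - v)) chebyshev_kernel"
  have c: "\<forall>(m, v)\<in>set c. m > 0" "(\<Sum>(m, v)\<leftarrow>c. real_of_int v / real m) = 0"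
    "(\<Sum>(m, v)\<leftarrow>c. \<bar>real_of_int v\<bar>) = 5"
    by (simp_all add: c_def chebyshev_kernel_def)
  have "(\<Sum>(m, v)\<leftarrow>c. real_of_int v * ln (real m) / real m) =
        - (\<Sum>(m, v)\<leftarrow>chebyshev_kernel. real_of_int v * ln (real m) / real m)"
    by (simp add: c_def chebyshev_kernel_def)
  hence "real n * (\<Sum>(m, v)\<leftarrow>c. real_of_int v * ln (real m) / real m) \<le> real n * 0.9213"
    using chebyshev_kernel_ln_sum(2) by (intro mult_left_mono) auto
  moreover have "kernel_sum c y \<le> step_sum [(1, -1), (6, 1)] y" for y
    using chebyshev_kernel_bounds(2)[of y] unfolding c_def kernel_sum_uminus
    by (auto simp: step_sum_def split: if_splits)
  from kernel_bound[OF assms c(1) _ c(2) this]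
  have "- (real n * (\<Sum>(m, v)\<leftarrow>c. real_of_int v * ln (real m) / real m)) - 5 * (ln n + 1)
        \<le> chebyshev_psi (n div 6) - chebyshev_psi n"
    by (simp add: c(3))
  ultimately show ?thesis by simp
qed

text \<open>Iterating the step gives the geometric factor 6/5, and 1.1056 exceeds 0.9213 * 6/5. The
  squared logarithm absorbs the accumulated logarithmic errors.\<close>

lemma chebyshev_psi_le:
  assumes "n > 0"
  shows "chebyshev_psi n \<le> 1.1056 * real n + 2.2 * (ln n + 1)\<^sup>2 + 5"
  using assms
proof (induction n rule: less_induct)
  case (less n)
  define t where "t = ln n + 1"
  have step: "chebyshev_psi n \<le> chebyshev_psi (n div 6) + 0.9213 * real n + 5 * t"
    unfolding t_def using chebyshev_psi_le_step less.prems by blast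
  show ?case
  proof (cases "n < 6")
    case True
    have "0 \<le> (2.2 * t - 2.5)\<^sup>2" by simp
    hence "5 * t \<le> 2.2 * t\<^sup>2 + 5" by (simp add: power2_eq_square algebra_simps)
    with step True show ?thesis
      unfolding t_def[symmetric] by (simp add: chebyshev_psi_def)
  next
    case False
    define m where "m = n div 6"
    have m: "0 < m" "m < n" "real m \<le> real n / 6"
      using False of_nat_div_le_of_nat[of n 6, where ?'a = real] by (auto simp: m_def div_greater_zero_iff)
    have ln6: "1.79 \<le> ln (6 :: real)"
      using ln_mult[of 2 "3 :: real"] ln_2_bounds ln_3_bounds by simp
    have "ln (real 6) \<le> ln (real n)" using False by (subst ln_le_cancel_iff) auto
    hence t: "t \<ge> 2.79" using ln6 by (simp add: t_def)
    have "ln m \<le> ln (real n / 6)" using m by (subst ln_le_cancel_iff) auto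
    also have "\<dots> = ln n - ln 6" using less.prems by (simp add: ln_div)
    finally have "ln m + 1 \<le> t - 1.79" using ln6 by (simp add: t_def)
    moreover have "0 \<le> ln m" using m by simp
    ultimately have "(ln m + 1)\<^sup>2 \<le> (t - 1.79)\<^sup>2" by (intro power_mono) auto
    \<comment> \<open>Lowering \<open>t\<close> by 1.79 saves
      \<open>2.2 * (3.58 * t - 1.79^2)\<close>, which exceeds \<open>5 * t\<close> once
      \<open>t >= 2.46\<close>.\<close>
    also have "2.2 * (t - 1.79)\<^sup>2 + 5 * t \<le> 2.2 * t\<^sup>2"
      using t by (simp add: power2_eq_square algebra_simps)
    finally have "2.2 * (ln m + 1)\<^sup>2 + 5 * t \<le> 2.2 * t\<^sup>2" by simp
    moreover have "chebyshev_psi m \<le> 1.1056 * real m + 2.2 * (ln m + 1)\<^sup>2 + 5"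
      using less.IH m by blast
    ultimately show ?thesis using step m(3) unfolding m_def[symmetric] t_def[symmetric] by simp
  qed
qed

section \<open>From psi to primes\<close>

text \<open>Here \<open>s\<close> stands for any upper bound on the integers up to
  \<open>sqrt (9 n)\<close>. Sending a proper prime power to its base preserves
  \<open>mangoldt\<close>, is injective on the interval and lands in \<open>{1..s}\<close>.\<close>

lemma chebyshev_psi_diff_le:
  assumes "n > 0" and s: "\<And>p. p\<^sup>2 \<le> 9 * n \<Longrightarrow> p \<le> s"
  shows "chebyshev_psi (9 * n) - chebyshev_psi (8 * n) \<le>
         card {p :: nat. prime p \<and> 8 * n < p \<and> p < 9 * n} * ln (9 * real n) + chebyshev_psi s"
proof -
  define P where "P = {p :: nat. prime p \<and> 8 * n < p \<and> p < 9 * n}"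
  define B where "B = {d \<in> {8 * n<..9 * n}. primepow d \<and> \<not> prime d}"
  have fin: "finite P" "finite B" unfolding P_def B_def by auto
  \<comment> \<open>The psi difference includes the endpoint \<open>9 * n\<close>, which the open
    interval omits.\<close>
  have "\<not> prime (9 * n)"
  proof
    assume "prime (9 * n)"
    hence *: "\<forall>m. m dvd 9 * n \<longrightarrow> m = 1 \<or> m = 9 * n"
      unfolding prime_nat_iff by (rule conjunct2)
    have "(3 :: nat) = 1 \<or> 3 = 9 * n" by (rule *[rule_format]) presburger
    thus False by presburger
  qed
  hence P_eq: "P = {d \<in> {8 * n<..9 * n}. prime d}"
    unfolding P_def by (auto intro!: le_neq_implies_less)
  have "{1..9 * n} = {1..8 * n} \<union> {8 * n<..9 * n}" by auto
  hence "chebyshev_psi (9 * n) - chebyshev_psi (8 * n) = (\<Sum>d\<in>{8 * n<..9 * n}. mangoldt d)"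
    unfolding chebyshev_psi_def by (simp only:) (subst sum.union_disjoint, auto)
  also have "\<dots> = (\<Sum>d\<in>P \<union> B. mangoldt d)"
    by (intro sum.mono_neutral_right) (auto simp: P_eq B_def mangoldt_def intro: primepow_prime)
  also have "\<dots> = (\<Sum>d\<in>P. mangoldt d) + (\<Sum>d\<in>B. mangoldt d)"
    using fin by (intro sum.union_disjoint) (auto simp: P_def B_def)
  also have "(\<Sum>d\<in>P. mangoldt d) \<le> (\<Sum>d\<in>P. ln (9 * real n))"
    using assms(1) by (intro sum_mono) (auto simp: P_def)
  also have "(\<Sum>d\<in>B. mangoldt d) = (\<Sum>d\<in>B. (mangoldt (aprimedivisor d) :: real))"
  proof (intro sum.cong refl)
    fix d assume "d \<in> B"
    hence "primepow d" by (simp add: B_def)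
    moreover from this have "prime (aprimedivisor d)"
      using aprimedivisor_nat(1)[of d] primepow_gt_Suc_0[of d] by simp
    ultimately show "mangoldt d = (mangoldt (aprimedivisor d) :: real)"
      by (simp add: mangoldt_def)
  qed
  also have "\<dots> = (\<Sum>p\<in>aprimedivisor ` B. mangoldt p)"
  proof (subst sum.reindex)
    show "inj_on aprimedivisor B"
    proof (rule inj_onI)
      have aux: False if "prime p" "8 * n < p ^ i" "p ^ j \<le> 9 * n" "i < j" for p i j :: nat
      proof -
        have "2 * p ^ i \<le> p ^ Suc i" using prime_ge_2_nat[OF that(1)] by simp
        also have "\<dots> \<le> p ^ j"
          using that prime_ge_1_nat[OF that(1)] by (intro power_increasing) auto
        finally show False using that assms(1) by linarith
      qed
      fix x y assume *: "x \<in> B" "y \<in> B" "aprimedivisor x = aprimedivisor y"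
      then obtain p i q j where "prime p" "x = p ^ i" "prime q" "y = q ^ j" "i > 0" "j > 0"
        by (auto simp: B_def primepow_def)
      moreover from this have "p = q" using * by (simp add: aprimedivisor_prime_power)
      ultimately show "x = y" using * aux[of p i j] aux[of p j i]
        by (cases i j rule: linorder_cases) (auto simp: B_def)
    qed
  qed simp
  also have "\<dots> \<le> chebyshev_psi s"
    unfolding chebyshev_psi_def
  proof (intro sum_mono2 subsetI)
    fix p assume "p \<in> aprimedivisor ` B"
    then obtain q k where d: "prime q" "k > 0" "q ^ k \<le> 9 * n" "\<not> prime (q ^ k)" "p = q"
      by (auto simp: B_def primepow_def aprimedivisor_prime_power)
    hence "k \<ge> 2" by (cases k; cases "k - 1") auto
    hence "q ^ 2 \<le> q ^ k" using prime_ge_1_nat[OF d(1)] by (intro power_increasing) auto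
    thus "p \<in> {1..s}" using d s[of q] prime_ge_1_nat[OF d(1)] by auto
  qed (auto simp: mangoldt_nonneg)
  finally show ?thesis by (simp add: P_def)
qed

section \<open>A lower bound for psi on the interval\<close>

lemma interval_kernel_weights:
  "\<forall>(m, v)\<in>set interval_kernel. m > 0"
  "(\<Sum>(m, v)\<leftarrow>interval_kernel. real_of_int v / real m) = 0"
  "(\<Sum>(m, v)\<leftarrow>interval_kernel. \<bar>real_of_int v\<bar>) = 14"
  by (simp_all add: interval_kernel_def)

lemma interval_kernel_ln_sum:
  "1.2324 \<le> - 72 * (\<Sum>(m, v)\<leftarrow>interval_kernel. real_of_int v * ln (real m) / real m)"
proof -
  have ln_eqs: "ln (8 :: real) = 3 * ln 2" "ln (9 :: real) = 2 * ln 3" "ln (16 :: real) = 4 * ln 2"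
    "ln (18 :: real) = ln 2 + 2 * ln 3" "ln (24 :: real) = 3 * ln 2 + ln 3"
    "ln (27 :: real) = 3 * ln 3" "ln (40 :: real) = 3 * ln 2 + ln 5" "ln (45 :: real) = 2 * ln 3 + ln 5"
    "ln (48 :: real) = 4 * ln 2 + ln 3" "ln (54 :: real) = ln 2 + 3 * ln 3"
    "ln (80 :: real) = 4 * ln 2 + ln 5" "ln (90 :: real) = ln 2 + 2 * ln 3 + ln 5"
    "ln (144 :: real) = 4 * ln 2 + 2 * ln 3" "ln (270 :: real) = ln 2 + 3 * ln 3 + ln 5"
    using ln_mult[of 2 "2 :: real"] ln_mult[of 2 "4 :: real"] ln_mult[of 3 "3 :: real"]
      ln_mult[of 2 "8 :: real"] ln_mult[of 2 "9 :: real"] ln_mult[of 3 "8 :: real"]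
      ln_mult[of 3 "9 :: real"] ln_mult[of 5 "8 :: real"] ln_mult[of 5 "9 :: real"]
      ln_mult[of 3 "16 :: real"] ln_mult[of 2 "27 :: real"] ln_mult[of 5 "16 :: real"]
      ln_mult[of 5 "18 :: real"] ln_mult[of 16 "9 :: real"] ln_mult[of 5 "54 :: real"]
    by simp_all
  have "- 72 * (\<Sum>(m, v)\<leftarrow>interval_kernel. real_of_int v * ln (real m) / real m) =
        - 13 / 3 * ln 2 + 41 / 10 * ln 3 - 1 / 6 * ln 5"
    by (simp add: interval_kernel_def ln_eqs field_simps)
  thus ?thesis using ln_2_bounds ln_3_bounds ln_5_bounds by (simp add: field_simps)
qed

text \<open>Evaluation at \<open>72 * n\<close> makes the steps at 8 and 9 fall exactly on
  \<open>9 * n\<close> and \<open>8 * n\<close>.\<close>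

lemma chebyshev_psi_interval_ge:
  assumes "n > 0"
  shows "1.2324 * real n - 14 * (ln (72 * real n) + 1) \<le>
    chebyshev_psi (9 * n) - chebyshev_psi (8 * n) + chebyshev_psi (72 * n div 56)
    - chebyshev_psi (72 * n div 63) + chebyshev_psi (72 * n div 88)
    - chebyshev_psi (72 * n div 153) + chebyshev_psi (72 * n div 243)"
proof -
  have div_eqs: "72 * n div 8 = 9 * n" "72 * n div 9 = 8 * n" by auto
  have "72 * n > 0" using assms by simp
  note bound = kernel_bound[OF this interval_kernel_weights(1) _ interval_kernel_weights(2)
      interval_kernel_le, unfolded interval_kernel_weights(3)]
  have "- real (72 * n) * (\<Sum>(m, v)\<leftarrow>interval_kernel. real_of_int v * ln (real m) / real m)
        - 14 * (ln (72 * real n) + 1) \<le>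
    chebyshev_psi (9 * n) - chebyshev_psi (8 * n) + chebyshev_psi (72 * n div 56)
    - chebyshev_psi (72 * n div 63) + chebyshev_psi (72 * n div 88)
    - chebyshev_psi (72 * n div 153) + chebyshev_psi (72 * n div 243)"
    using bound by (simp add: interval_steps_def div_eqs)
  moreover have "1.2324 * real n \<le>
    - real (72 * n) * (\<Sum>(m, v)\<leftarrow>interval_kernel. real_of_int v * ln (real m) / real m)"
    using mult_left_mono[OF interval_kernel_ln_sum, of "real n"] by (simp add: mult_ac)
  ultimately show ?thesis by linarith
qed

text \<open>The condition \<open>k >= 36\<close> keeps the quotient at most \<open>2 * n\<close>, so
  one logarithm serves every step; \<open>n >= k\<close> keeps it positive. The extra 1 pays for
  rounding down.\<close>

lemma chebyshev_psi_div_bounds: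
  assumes "k \<ge> 36" "n \<ge> k"
  shows "chebyshev_psi (72 * n div k) \<le> 1.1056 * (72 * real n / k) + 2.2 * (ln (2 * real n) + 1)\<^sup>2 + 5"
    and "0.9212 * (72 * real n / k) - 1 - 5 * (ln (2 * real n) + 1) \<le> chebyshev_psi (72 * n div k)"
proof -
  define m where "m = 72 * n div k"
  have m: "m > 0" unfolding m_def using assms by (simp add: div_greater_zero_iff)
  have "72 * n \<le> 2 * n * k" using assms by simp
  hence "m \<le> 2 * n" unfolding m_def using assms
    by (metis div_le_mono div_mult_self_is_m gr0I le_zero_eq mult.commute zero_neq_numeral)
  hence "real m \<le> 2 * real n" by linarith
  hence ln_m: "0 \<le> ln m" "ln m \<le> ln (2 * real n)" using m by auto
  hence "(ln m + 1)\<^sup>2 \<le> (ln (2 * real n) + 1)\<^sup>2" by (intro power_mono) auto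
  moreover have "real m \<le> 72 * real n / k"
    unfolding m_def using of_nat_div_le_of_nat[of "72 * n" k, where ?'a = real] by simp
  ultimately show "chebyshev_psi m \<le> 1.1056 * (72 * real n / k) + 2.2 * (ln (2 * real n) + 1)\<^sup>2 + 5"
    using chebyshev_psi_le[OF m] by simp
  have "72 * n \<le> (1 + m) * k"
    unfolding m_def using assms dividend_less_div_times[of k "72 * n"] by (simp add: algebra_simps)
  hence "real (72 * n) \<le> real ((1 + m) * k)" by (simp only: of_nat_le_iff)
  hence "72 * real n / k - 1 \<le> m" using assms by (simp add: field_simps)
  hence "0.9212 * (72 * real n / k - 1) \<le> 0.9212 * m" by (intro mult_left_mono) auto
  also have "\<dots> \<le> chebyshev_psi m + 5 * (ln (2 * real n) + 1)"
    using chebyshev_psi_ge[OF m] ln_m by simp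
  finally show "0.9212 * (72 * real n / k) - 1 - 5 * (ln (2 * real n) + 1) \<le> chebyshev_psi m"
    by (simp add: right_diff_distrib)
qed

section \<open>Numerical conclusion\<close>

lemma card_primes_ge:
  fixes n :: nat
  assumes "n \<ge> 40000"
  shows "0.0342 * real n - 7.53 * sqrt n \<le>
         card {p :: nat. prime p \<and> 8 * n < p \<and> p < 9 * n} * ln (9 * real n)"
proof -
  define w where "w = sqrt n"
  define t where "t = ln (2 * real n) + 1"
  define s where "s = nat \<lfloor>3 * w\<rfloor>"
  define C where "C = card {p :: nat. prime p \<and> 8 * n < p \<and> p < 9 * n} * ln (9 * real n)"
  have w2: "real n = w\<^sup>2" by (simp add: w_def)
  have w: "w \<ge> 200" unfolding w_def by (rule real_le_rsqrt) (use assms in simp)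
  \<comment> \<open>The tangent of \<open>ln\<close> at 200 makes all logarithms linear in
    \<open>w\<close>, reducing the claim to a quadratic inequality.\<close>
  have "ln w = ln 200 + ln (w / 200)" using w by (simp add: ln_div)
  also have "ln (w / 200) \<le> w / 200 - 1" using w by (intro ln_le_minus_one) auto
  also have "ln (200 :: real) = 3 * ln 2 + 2 * ln 5"
    using ln_mult[of 2 "2 :: real"] ln_mult[of 2 "4 :: real"] ln_mult[of 5 "5 :: real"]
      ln_mult[of 8 "25 :: real"] by simp
  finally have ln_w: "ln w \<le> 4.2986 + w / 200" using ln_2_bounds ln_5_bounds by simp
  have ln_n: "ln n = 2 * ln w" unfolding w2 using w by (simp add: ln_realpow)
  have "t = ln 2 + 2 * ln w + 1" using w assms by (simp add: t_def ln_mult ln_n)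
  hence t: "t \<le> 10.3 + w / 100" using ln_w ln_2_bounds by simp
  have "t \<ge> 0" using assms by (simp add: t_def)
  hence "t\<^sup>2 \<le> (10.3 + w / 100)\<^sup>2" using t by (intro power_mono)
  hence t2: "t\<^sup>2 \<le> 106.09 + 0.206 * w + 0.0001 * w\<^sup>2"
    by (simp add: power2_eq_square algebra_simps)
  have "ln (72 :: real) = 3 * ln 2 + 2 * ln 3"
    using ln_mult[of 2 "2 :: real"] ln_mult[of 2 "4 :: real"] ln_mult[of 3 "3 :: real"]
      ln_mult[of 8 "9 :: real"] by simp
  hence ln72: "ln (72 * real n) + 1 \<le> 13.88 + w / 100"
    using ln_w ln_2_bounds ln_3_bounds assms by (simp add: ln_mult ln_n)

  have s: "s > 0" "real s \<le> 3 * w" using w unfolding s_def by auto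
  have "p \<le> s" if "p\<^sup>2 \<le> 9 * n" for p
  proof -
    have "real (p\<^sup>2) \<le> real (9 * n)" using that by (simp only: of_nat_le_iff)
    hence "(real p)\<^sup>2 \<le> (3 * w)\<^sup>2" by (simp add: w2 power_mult_distrib)
    from power2_le_imp_le[OF this] have "real p \<le> 3 * w" using w by simp
    thus ?thesis unfolding s_def by linarith
  qed
  hence 1: "chebyshev_psi (9 * n) - chebyshev_psi (8 * n) \<le> C + chebyshev_psi s"
    unfolding C_def using chebyshev_psi_diff_le[of n s] assms by simp
  have "3 * w \<le> 2 * real n" using w by (simp add: w2 power2_eq_square)
  hence "ln s \<le> ln (2 * real n)" using s assms by (subst ln_le_cancel_iff) auto
  moreover have "0 \<le> ln s" using s by simp
  ultimately have "(ln s + 1)\<^sup>2 \<le> t\<^sup>2" unfolding t_def by (intro power_mono) auto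
  hence 2: "chebyshev_psi s \<le> 3.3168 * w + 2.2 * t\<^sup>2 + 5"
    using chebyshev_psi_le[OF s(1)] s(2) by simp
  \<comment> \<open>The coefficient is \<open>1.2324 - 1.1056 * 72 * (1/56 + 1/88 + 1/243) + 0.9212
    * 72 * (1/63 + 1/153)\<close>, rounded down.\<close>
  have "0.065 * w\<^sup>2 - 6.6 * t\<^sup>2 - 10 * t - 17 - 14 * (13.88 + w / 100) \<le>
        chebyshev_psi (9 * n) - chebyshev_psi (8 * n)"
    using chebyshev_psi_interval_ge[of n] ln72 assms
      chebyshev_psi_div_bounds(1)[of 56 n] chebyshev_psi_div_bounds(1)[of 88 n]
      chebyshev_psi_div_bounds(1)[of 243 n] chebyshev_psi_div_bounds(2)[of 63 n]
      chebyshev_psi_div_bounds(2)[of 153 n]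
    unfolding t_def[symmetric] w2[symmetric] by simp
  with 1 2 t t2 have 3: "0.06412 * w\<^sup>2 - 5.3696 * w - 1252.912 \<le> C"
    by simp
  have "200 * w \<le> w\<^sup>2" using w by (simp add: power2_eq_square)
  with 3 w have "0.0342 * w\<^sup>2 - 7.53 * w \<le> C" by simp
  thus ?thesis unfolding C_def w2[symmetric] unfolding w_def .
qed

lemma ln_mult_exp_powr:
  fixes a x y z :: real
  assumes "a > 0" "x > 0" "y > 0" "z > 0"
  shows "ln (a * exp b * x powr c * y powr d * z powr e) = ln a + b + c * ln x + d * ln y + e * ln z"
  using assms by (simp add: ln_mult ln_powr)

text \<open>The last power contributes exactly \<open>- 2.51012 * 3 * sqrt n\<close>, since
  \<open>ln (9 n)\<close> cancels. The factor \<open>n powr (- 13)\<close> outweighs 32549.3 because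
  \<open>n >= 5\<close>, and 0.5084 - 1.001102 * 9/19 is below 0.0342.\<close>

lemma ln_claimed_bound_le:
  fixes n :: nat
  assumes "n > 4"
  shows "ln (32549.3 * exp (- 1.001102 * (9 * real n / 19)) * real n powr (- 13)
            * (9 ^ 9 / 8 ^ 8) powr (17 * real n / 105)
            * (9 * real n) powr (- (2.51012 * sqrt (9 * real n) / ln (9 * real n))))
         \<le> 0.0342 * real n - 7.53 * sqrt n"
proof -
  have "sqrt (9 * real n) = 3 * sqrt n" by (simp add: real_sqrt_mult)
  moreover have "ln (9 * real n) > 0" using assms by simp
  ultimately have eq: "ln (32549.3 * exp (- 1.001102 * (9 * real n / 19)) * real n powr (- 13)
            * (9 ^ 9 / 8 ^ 8) powr (17 * real n / 105)
            * (9 * real n) powr (- (2.51012 * sqrt (9 * real n) / ln (9 * real n))))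
     = ln 32549.3 - 1.001102 * (9 * real n / 19) - 13 * ln n
         + 17 * real n / 105 * ln (9 ^ 9 / 8 ^ 8) - 2.51012 * (3 * sqrt n)"
    using assms by (subst ln_mult_exp_powr) auto
  have "ln (9 ^ 9 / 8 ^ 8 :: real) = ln (9 ^ 9) - ln (8 ^ 8)" by (subst ln_div) auto
  also have "ln (9 ^ 9 :: real) = 9 * ln 9" by (subst ln_realpow) auto
  also have "ln (8 ^ 8 :: real) = 8 * ln 8" by (subst ln_realpow) auto
  also have "9 * ln 9 - 8 * ln 8 = 18 * ln 3 - 24 * ln (2 :: real)"
    using ln_mult[of 2 "2 :: real"] ln_mult[of 2 "4 :: real"] ln_mult[of 3 "3 :: real"] by simp
  finally have "17 / 105 * ln (9 ^ 9 / 8 ^ 8 :: real) \<le> 0.5084"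
    using ln_2_bounds ln_3_bounds by simp
  hence "real n * (17 / 105 * ln (9 ^ 9 / 8 ^ 8)) \<le> real n * 0.5084"
    by (intro mult_left_mono) auto
  moreover have "ln (32549.3 :: real) \<le> 13 * ln n"
  proof -
    have "ln (32549.3 :: real) \<le> ln (5 ^ 13)" by (subst ln_le_cancel_iff) auto
    also have "\<dots> = 13 * ln 5" by (subst ln_realpow) auto
    also have "\<dots> \<le> 13 * ln n" using assms by simp
    finally show ?thesis .
  qed
  moreover define r where "r = sqrt n"
  have "r \<ge> 0" by (simp add: r_def)
  ultimately show ?thesis unfolding eq r_def[symmetric] by simp
qed

theorem theorem4p0p3:
  fixes n :: nat
  assumes "n > 4"
  shows "log (9 * real n)
           (32549.3 * exp (- 1.001102 * (9 * real n / 19)) * real n powr (- 13)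
            * (9 ^ 9 / 8 ^ 8) powr (17 * real n / 105)
            * (9 * real n) powr (- (2.51012 * sqrt (9 * real n) / ln (9 * real n))))
         \<le> real (card {p :: nat. prime p \<and> 8 * n < p \<and> p < 9 * n})"
proof -
  have "0.0342 * real n - 7.53 * sqrt n \<le>
        card {p :: nat. prime p \<and> 8 * n < p \<and> p < 9 * n} * ln (9 * real n)"
  proof (cases "n \<ge> 40000")
    case False
    \<comment> \<open>Here \<open>0.0342 * n <= 6.84 * sqrt n\<close>, so the left side is not
      positive.\<close>
    hence "sqrt n \<le> sqrt 40000" by (intro real_sqrt_le_mono) simp
    also have "\<dots> = 200" by (rule real_sqrt_unique) auto
    finally have "sqrt n * sqrt n \<le> 200 * sqrt n" by (intro mult_right_mono) auto
    hence "0.0342 * real n - 7.53 * sqrt n \<le> 0" by simp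
    also have "0 \<le> card {p :: nat. prime p \<and> 8 * n < p \<and> p < 9 * n} * ln (9 * real n)"
      using assms by simp
    finally show ?thesis .
  qed (rule card_primes_ge)
  with ln_claimed_bound_le[OF assms] show ?thesis
    using assms unfolding log_def by (subst pos_divide_le_eq) auto
qed

end
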